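(* Let $X$ be a nonempty $T_0$ space, let $\mathscr{S}$ be a subbase of $X$ with $\emptyset\notin\mathscr{S}$, let $Y_S$ be a nonempty topological space for each $S\in\mathscr{S}$, and let $Y$ be the amalgam of $\langle Y_S\rangle_{S\in\mathscr{S}}$. Suppose $i\in\{1,2,3,3\frac{1}{2}\}$, $X$ has a proper $T_i$ connectification $\tilde{X}$, and $Y_S$ is $T_i$ for all $S\in\mathscr{S}$. Then $Y$ has a proper $T_i$ connectification $\tilde{Y}$. Moreover, if $\tilde{X}$ is path-connected, then we may choose $\tilde{Y}$ to be path-connected.
   Context: Amalgam: let $X$ be a nonempty $T_0$ space, $\mathscr{S}$ a subbase of $X$ (a family of open sets whose finite intersections, the empty intersection being $X$, form a base) with $\emptyset\notin\mathscr{S}$, and $Y_S$ a nonempty topological space for each $S\in\mathscr{S}$. The amalgam of $\langle Y_S\rangle_{S\in\mathscr{S}}$ is the set $Y=\bigcup_{p\in X}\prod_{p\in S\in\mathscr{S}}Y_S$, where the product over $p\in S\in\mathscr{S}$ is the set of functions $y$ with domain $\{S\in\mathscr{S}:p\in S\}$ such that $y(S)\in Y_S$ for all $S$ in the domain. It is topologized by taking as a subbase all sets $\{y\in Y: S\in\mathrm{dom}\,y\text{ and }y(S)\in U\}$ with $S\in\mathscr{S}$ and $U$ open in $Y_S$. $X$ is called the base space of $Y$ and the $Y_S$ its factors. A connected space $W$ is a connectification of a space $V$ if $V$ can be densely embedded in $W$; it is proper if the dense embedding can be chosen not to be surjective. A $T_i$ connectification is a connectification that is itself a $T_i$ space. $T_3$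 means regular and $T_1$; $T_{3\frac12}$ means completely regular and $T_1$. *)

theory Defs
  imports "HOL-Analysis.Analysis"
begin

definition subbase_of :: "'a topology \<Rightarrow> 'a set set \<Rightarrow> bool" where
  "subbase_of X \<S> \<longleftrightarrow>
     (\<forall>S\<in>\<S>. openin X S) \<and>
     openin X = arbitrary union_of (finite intersection_of (\<lambda>S. S \<in> \<S>) relative_to topspace X)"

(* A point of the amalgam is a function whose domain varies with the point; it is encoded as
   a partial map, so that "dom" is literally the domain. *)
definition amalgam_points ::
  "'a topology \<Rightarrow> 'a set set \<Rightarrow> ('a set \<Rightarrow> 'b topology) \<Rightarrow> ('a set \<rightharpoonup> 'b) set" where
  "amalgam_points X \<S> Y =
     (\<Union>p\<in>topspace X. {y. dom y = {S \<in> \<S>. p \<in> S} \<and> (\<forall>S\<in>dom y. the (y S) \<in> topspace (Y S))})"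

(* Taking finite intersections relative to the point set makes the empty intersection the
   whole amalgam, also when \<S> is empty. *)
definition amalgam ::
  "'a topology \<Rightarrow> 'a set set \<Rightarrow> ('a set \<Rightarrow> 'b topology) \<Rightarrow> ('a set \<rightharpoonup> 'b) topology" where
  "amalgam X \<S> Y =
     topology (arbitrary union_of
       (finite intersection_of
          (\<lambda>B. \<exists>S\<in>\<S>. \<exists>U. openin (Y S) U \<and>
             B = {y \<in> amalgam_points X \<S> Y. S \<in> dom y \<and> the (y S) \<in> U})
        relative_to amalgam_points X \<S> Y))"

definition dense_embedding :: "'a topology \<Rightarrow> 'b topology \<Rightarrow> ('a \<Rightarrow> 'b) \<Rightarrow> bool" where
  "dense_embedding V W e \<longleftrightarrow>
     embedding_map V W e \<and> W closure_of (e ` topspace V) = topspace W"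

definition connectification :: "'b topology \<Rightarrow> 'a topology \<Rightarrow> bool" where
  "connectification W V \<longleftrightarrow> connected_space W \<and> (\<exists>e. dense_embedding V W e)"

definition proper_connectification :: "'b topology \<Rightarrow> 'a topology \<Rightarrow> bool" where
  "proper_connectification W V \<longleftrightarrow>
     connectification W V \<and> (\<exists>e. dense_embedding V W e \<and> e ` topspace V \<noteq> topspace W)"

(* The admissible indices i = 1, 2, 3, 3 1/2, reified as a datatype so that a single
   variable i can select the same axiom for topologies on different types. *)
datatype sep_index = I1 | I2 | I3 | I3half

fun T_space :: "sep_index \<Rightarrow> 'a topology \<Rightarrow> bool" where
  "T_space I1 X \<longleftrightarrow> t1_space X"
| "T_space I2 X \<longleftrightarrow> Hausdorff_space X"
| "T_space I3 X \<longleftrightarrow> regular_space X \<and> t1_space X"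
| "T_space I3half X \<longleftrightarrow> completely_regular_space X \<and> t1_space X"

end

(* Identify X with a dense subspace of Xt and fix a point p of Xt outside X. Since Xt is T_1, every
   S in the subbase is the trace on X of an open set T S of Xt that misses p. Let Yt be the amalgam
   over Xt in which the factor Y_S sits over T S (sets of Xt other than the T S carry trivial
   factors). A choice f of a point in every factor gives a continuous section
   q |-> (q, f restricted to {S. q in T S}) of Yt over Xt. The sections cover Yt, and all of them
   agree over p, where the domain is empty. Hence Yt inherits connectedness, path-connectedness and
   the density of Y from Xt. *)

theory Submission
  imports Defs
begin

section \<open>Separation axioms from a generating family\<close>

text \<open>Induction on the generation of an open set: shrinking a neighbourhood of a point to a
  closed one survives finite intersections, by intersecting the witnesses, and arbitrary unions, by
  keeping the witness for one member. Only the generators have to be examined.\<close>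

lemma regular_space_topology_generated_by:
  assumes "\<And>B x. \<lbrakk>B \<in> \<B>; x \<in> B\<rbrakk> \<Longrightarrow> \<exists>U C. openin (topology_generated_by \<B>) U \<and>
      closedin (topology_generated_by \<B>) C \<and> x \<in> U \<and> U \<subseteq> C \<and> C \<subseteq> B"
  shows "regular_space (topology_generated_by \<B>)"
proof -
  let ?X = "topology_generated_by \<B>"
  have "\<forall>x\<in>W. \<exists>U C. openin ?X U \<and> closedin ?X C \<and> x \<in> U \<and> U \<subseteq> C \<and> C \<subseteq> W"
    if "generate_topology_on \<B> W" for W
    using that
  proof induction
    case (Int a b)
    show ?case
    proof
      fix x assume "x \<in> a \<inter> b"
      then have x: "x \<in> a" "x \<in> b" by simp_all
      obtain U C where UC: "openin ?X U" "closedin ?X C" "x \<in> U" "U \<subseteq> C" "C \<subseteq> a"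
        using bspec[OF Int.IH(1) x(1)] by (elim exE conjE)
      obtain U' C' where UC': "openin ?X U'" "closedin ?X C'" "x \<in> U'" "U' \<subseteq> C'" "C' \<subseteq> b"
        using bspec[OF Int.IH(2) x(2)] by (elim exE conjE)
      show "\<exists>U C. openin ?X U \<and> closedin ?X C \<and> x \<in> U \<and> U \<subseteq> C \<and> C \<subseteq> a \<inter> b"
      proof (intro exI conjI)
        show "openin ?X (U \<inter> U')" "closedin ?X (C \<inter> C')"
          using UC UC' by auto
      qed (use UC UC' in auto)
    qed
  next
    case (UN K)
    then show ?case by (meson Union_iff Union_upper order_trans)
  next
    case (Basis B)
    then show ?case using assms by blast
  qed simp
  then show ?thesis
    unfolding neighbourhood_base_of_closedin[symmetric] neighbourhood_base_of
    by (metis openin_topology_generated_by)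
qed

text \<open>The same induction, with a separating function in place of a closed neighbourhood.
  Asking only for values at least 1 off the set, instead of values in the unit interval, keeps the
  inductive property easy to combine.\<close>

lemma completely_regular_space_topology_generated_by:
  assumes "\<And>B x. \<lbrakk>B \<in> \<B>; x \<in> B\<rbrakk> \<Longrightarrow>
      \<exists>f. continuous_map (topology_generated_by \<B>) euclideanreal f \<and> f x = 0 \<and>
        (\<forall>z\<in>topspace (topology_generated_by \<B>) - B. 1 \<le> f z)"
  shows "completely_regular_space (topology_generated_by \<B>)"
proof -
  let ?X = "topology_generated_by \<B>"
  have gen: "\<forall>x\<in>W. \<exists>f. continuous_map ?X euclideanreal f \<and> f x = 0 \<and> (\<forall>z\<in>topspace ?X - W. 1 \<le> f z)"
    if "generate_topology_on \<B> W" for W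
    using that
  proof induction
    case (Int a b)
    show ?case
    proof
      fix x assume "x \<in> a \<inter> b"
      then have x: "x \<in> a" "x \<in> b" by simp_all
      obtain f where f: "continuous_map ?X euclideanreal f" "f x = 0" "\<forall>z\<in>topspace ?X - a. 1 \<le> f z"
        using bspec[OF Int.IH(1) x(1)] by (elim exE conjE)
      obtain g where g: "continuous_map ?X euclideanreal g" "g x = 0" "\<forall>z\<in>topspace ?X - b. 1 \<le> g z"
        using bspec[OF Int.IH(2) x(2)] by (elim exE conjE)
      show "\<exists>f. continuous_map ?X euclideanreal f \<and> f x = 0 \<and> (\<forall>z\<in>topspace ?X - (a \<inter> b). 1 \<le> f z)"
      proof (intro exI conjI)
        \<comment> \<open>A point outside \<open>a \<inter> b\<close> misses \<open>a\<close> or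
          \<open>b\<close>, so one of the two functions, and hence their maximum, is at least 1
          there.\<close>
        show "continuous_map ?X euclideanreal (\<lambda>z. max (f z) (g z))"
          using f g by (intro continuous_map_real_max)
      qed (use f g in \<open>auto simp: le_max_iff_disj\<close>)
    qed
  next
    case (UN K)
    show ?case
    proof
      fix x assume "x \<in> \<Union>K"
      then obtain k where k: "k \<in> K" "x \<in> k" by blast
      then obtain f where "continuous_map ?X euclideanreal f" "f x = 0" "\<forall>z\<in>topspace ?X - k. 1 \<le> f z"
        using UN.IH by meson
      with k show "\<exists>f. continuous_map ?X euclideanreal f \<and> f x = 0 \<and> (\<forall>z\<in>topspace ?X - \<Union>K. 1 \<le> f z)"
        by (intro exI[of _ f]) auto
    qed
  next
    case (Basis B)
    then show ?case using assms by blast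
  qed simp
  show ?thesis
    unfolding completely_regular_space_alt'
  proof (intro allI impI)
    fix W x assume "openin ?X W" "x \<in> W"
    then obtain f where f: "continuous_map ?X euclideanreal f" "f x = 0" "\<forall>z\<in>topspace ?X - W. 1 \<le> f z"
      using gen openin_topology_generated_by by meson
    show "\<exists>f. continuous_map ?X euclideanreal f \<and> f x = 0 \<and> f ` (topspace ?X - W) \<subseteq> {1}"
    proof (intro exI conjI)
      \<comment> \<open>Truncation at 1 turns "at least 1 off \<open>W\<close>" into "equal to 1 off
        \<open>W\<close>" and leaves the value 0 at \<open>x\<close>.\<close>
      show "continuous_map ?X euclideanreal (\<lambda>z. min (f z) 1)"
        using f by (intro continuous_map_real_min) auto
    qed (use f in auto)
  qed
qed

text \<open>This form of complete regularity records the bounds 0 and 1 on the whole space, because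
  products of such functions are squeezed later on.\<close>

lemma completely_regular_space_bump:
  assumes "completely_regular_space X" "openin X W" "a \<in> W"
  obtains f :: "'a \<Rightarrow> real" where "continuous_map X euclideanreal f" "f a = 0"
    "\<forall>b\<in>topspace X. 0 \<le> f b \<and> f b \<le> 1" "\<forall>b\<in>topspace X - W. f b = 1"
proof -
  have "closedin X (topspace X - W) \<and> a \<in> topspace X - (topspace X - W)"
    using assms(2,3) openin_subset by auto
  then have "\<exists>f::'a \<Rightarrow> real. continuous_map X (top_of_set {0..1}) f \<and> f a = 0 \<and>
      f ` (topspace X - W) \<subseteq> {1}"
    using assms(1)[unfolded completely_regular_space_def, rule_format] by simp
  then obtain f :: "'a \<Rightarrow> real" where f: "continuous_map X (top_of_set {0..1}) f" "f a = 0"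
      "f ` (topspace X - W) \<subseteq> {1}"
    by (elim exE conjE)
  show thesis
  proof (rule that)
    show "continuous_map X euclideanreal f"
      using f(1) by (rule continuous_map_into_fulltopology)
    show "\<forall>b\<in>topspace X. 0 \<le> f b \<and> f b \<le> 1"
      using continuous_map_image_subset_topspace[OF f(1)] by (auto simp: Pi_iff)
  qed (use f in auto)
qed

text \<open>On \<open>W\<close> the product lies between 0 and \<open>F\<close>, and
  \<open>F\<close> is continuous on all of \<open>X\<close> and vanishes off \<open>W\<close>. So
  the product is forced to 0 at the boundary of \<open>W\<close>, even where \<open>G\<close> has no
  limit. The proof checks that the strict upper and lower level sets are open.\<close>

lemma continuous_map_extend_by_zero:
  fixes F G :: "'a \<Rightarrow> real"
  assumes W: "openin X W"
    and F: "continuous_map X euclideanreal F"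
    and G: "continuous_map (subtopology X W) euclideanreal G"
    and F0: "\<And>x. x \<in> topspace X \<Longrightarrow> 0 \<le> F x" "\<And>x. x \<in> topspace X - W \<Longrightarrow> F x = 0"
    and G01: "\<And>x. x \<in> W \<Longrightarrow> 0 \<le> G x \<and> G x \<le> 1"
  shows "continuous_map X euclideanreal (\<lambda>x. if x \<in> W then F x * G x else 0)"
    (is "continuous_map _ _ ?k")
proof -
  have WX: "W \<subseteq> topspace X" using W openin_subset by blast
  have FG: "continuous_map (subtopology X W) euclideanreal (\<lambda>x. F x * G x)"
    by (intro continuous_map_real_mult continuous_map_from_subtopology F G)
  have up: "openin X {x \<in> W. F x * G x > a}" and down: "openin X {x \<in> W. F x * G x < a}" for a
    using FG WX W unfolding continuous_map_upper_lower_semicontinuous_lt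
    by (auto simp: openin_open_subtopology Int_absorb1)
  have le: "F x * G x \<le> F x" "0 \<le> F x * G x" if "x \<in> W" for x
    using that WX F0(1)[of x] G01[of x] by (auto simp: mult_left_le)
  show ?thesis
    unfolding continuous_map_upper_lower_semicontinuous_lt
  proof (intro conjI allI)
    fix a :: real
    show "openin X {x \<in> topspace X. ?k x > a}"
    proof (cases "a < 0")
      case True
      then have "{x \<in> topspace X. ?k x > a} = topspace X"
        using le by force
      then show ?thesis by simp
    next
      case False
      \<comment> \<open>For \<open>a \<ge> 0\<close> the value 0 taken off \<open>W\<close> does not
        exceed \<open>a\<close>.\<close>
      then have "{x \<in> topspace X. ?k x > a} = {x \<in> W. F x * G x > a}"
        using WX by auto
      then show ?thesis using up by simp
    qed
    show "openin X {x \<in> topspace X. ?k x < a}"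
    proof (cases "a \<le> 0")
      case True
      then have "{x \<in> topspace X. ?k x < a} = {}"
        using le by force
      then show ?thesis by (simp only: openin_empty)
    next
      case False
      \<comment> \<open>For \<open>a > 0\<close> the open set where \<open>F x < a\<close> contains
        every point off \<open>W\<close>, together with a neighbourhood of it. It adds no wrong
        point of \<open>W\<close>, since the product is at most \<open>F\<close>.\<close>
      then have "{x \<in> topspace X. ?k x < a} = {x \<in> topspace X. F x < a} \<union> {x \<in> W. F x * G x < a}"
        using WX le(1) F0(2) by (auto intro: order_le_less_trans)
      moreover have "openin X {x \<in> topspace X. F x < a}"
        using F unfolding continuous_map_upper_lower_semicontinuous_lt by blast
      ultimately show ?thesis using down by (simp only: openin_Un)
    qed
  qed
qed

lemma T_space_imp_t1_space: "T_space i X \<Longrightarrow> t1_space X"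
  by (cases i) (auto simp: Hausdorff_imp_t1_space)

section \<open>Amalgams over a family of open sets\<close>

locale indexed_amalgam =
  fixes Z :: "'c topology" and I :: "'i set" and T :: "'i \<Rightarrow> 'c set" and Y :: "'i \<Rightarrow> 'b topology"
  assumes open_T: "i \<in> I \<Longrightarrow> openin Z (T i)"
begin

text \<open>The sets \<open>T i\<close> need not separate the points of \<open>Z\<close>, so the
  domain of the partial map does not determine the base point. The base point is therefore stored as
  the first component.\<close>

definition points :: "('c \<times> ('i \<rightharpoonup> 'b)) set" where
  "points = {z. fst z \<in> topspace Z \<and> dom (snd z) = {i \<in> I. fst z \<in> T i} \<and>
     (\<forall>i\<in>dom (snd z). the (snd z i) \<in> topspace (Y i))}"

definition base_cyl :: "'c set \<Rightarrow> ('c \<times> ('i \<rightharpoonup> 'b)) set" where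
  "base_cyl V = {z \<in> points. fst z \<in> V}"

definition fibre_cyl :: "'i \<Rightarrow> 'b set \<Rightarrow> ('c \<times> ('i \<rightharpoonup> 'b)) set" where
  "fibre_cyl i U = {z \<in> points. i \<in> dom (snd z) \<and> the (snd z i) \<in> U}"

text \<open>The base cylinders take the place of one-point factors over the open sets of
  \<open>Z\<close>: such a coordinate carries no information except whether the base point lies in
  the set.\<close>

definition cyls :: "('c \<times> ('i \<rightharpoonup> 'b)) set set" where
  "cyls = {base_cyl V |V. openin Z V} \<union> {fibre_cyl i U |i U. i \<in> I \<and> openin (Y i) U}"

definition total :: "('c \<times> ('i \<rightharpoonup> 'b)) topology" where
  "total = topology_generated_by cyls"

lemma mem_dom_iff: "z \<in> points \<Longrightarrow> i \<in> dom (snd z) \<longleftrightarrow> i \<in> I \<and> fst z \<in> T i"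
  by (simp add: points_def)

lemma coordinate_in_topspace: "\<lbrakk>z \<in> points; i \<in> dom (snd z)\<rbrakk> \<Longrightarrow> the (snd z i) \<in> topspace (Y i)"
  by (simp add: points_def)

lemma mem_base_cyl [simp]: "z \<in> base_cyl V \<longleftrightarrow> z \<in> points \<and> fst z \<in> V"
  by (simp add: base_cyl_def)

lemma mem_fibre_cyl [simp]:
  "z \<in> fibre_cyl i U \<longleftrightarrow> z \<in> points \<and> i \<in> I \<and> fst z \<in> T i \<and> the (snd z i) \<in> U"
  unfolding fibre_cyl_def using mem_dom_iff[of z i] by blast

lemma base_cyl_topspace: "base_cyl (topspace Z) = points"
  by (auto simp: base_cyl_def points_def)

lemma topspace_total [simp]: "topspace total = points"
proof -
  have "points \<in> cyls"
    using base_cyl_topspace unfolding cyls_def by blast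
  moreover have "\<Union>cyls \<subseteq> points"
    by (auto simp: cyls_def base_cyl_def fibre_cyl_def)
  ultimately show ?thesis
    unfolding total_def topology_generated_by_topspace by blast
qed

lemma openin_base_cyl: "openin Z V \<Longrightarrow> openin total (base_cyl V)"
  unfolding total_def by (rule topology_generated_by_Basis) (auto simp: cyls_def)

lemma openin_fibre_cyl: "\<lbrakk>i \<in> I; openin (Y i) U\<rbrakk> \<Longrightarrow> openin total (fibre_cyl i U)"
  unfolding total_def by (rule topology_generated_by_Basis) (auto simp: cyls_def)

lemma continuous_map_into_total:
  assumes "f \<in> topspace X \<rightarrow> points"
    and "\<And>V. openin Z V \<Longrightarrow> openin X {x \<in> topspace X. fst (f x) \<in> V}"
    and "\<And>i U. \<lbrakk>i \<in> I; openin (Y i) U\<rbrakk> \<Longrightarrow>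
      openin X {x \<in> topspace X. i \<in> dom (snd (f x)) \<and> the (snd (f x) i) \<in> U}"
  shows "continuous_map X total f"
  unfolding total_def
proof (rule continuous_on_generated_topo)
  fix B assume "B \<in> cyls"
  then consider V where "B = base_cyl V" "openin Z V"
    | i U where "B = fibre_cyl i U" "i \<in> I" "openin (Y i) U"
    unfolding cyls_def by blast
  then show "openin X (f -` B \<inter> topspace X)"
  proof cases
    case 1
    then have "f -` B \<inter> topspace X = {x \<in> topspace X. fst (f x) \<in> V}"
      using assms(1) by (auto simp: base_cyl_def)
    with 1 show ?thesis using assms(2) by simp
  next
    case 2
    then have "f -` B \<inter> topspace X = {x \<in> topspace X. i \<in> dom (snd (f x)) \<and> the (snd (f x) i) \<in> U}"
      using assms(1) by (auto simp: fibre_cyl_def)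
    with 2 show ?thesis using assms(3) by simp
  qed
next
  show "f ` topspace X \<subseteq> \<Union>cyls"
    using assms(1) topspace_total unfolding total_def topology_generated_by_topspace by blast
qed

lemma continuous_map_fst_total: "continuous_map total Z fst"
  unfolding continuous_map_alt
proof (intro conjI allI impI)
  fix V assume V: "openin Z V"
  have "fst -` V \<inter> topspace total = base_cyl V"
    by (auto simp: base_cyl_def)
  then show "openin total (fst -` V \<inter> topspace total)"
    using openin_base_cyl[OF V] by simp
qed (auto simp: points_def)

text \<open>The coordinate \<open>i\<close> exists only over \<open>T i\<close>, hence the
  restriction to the open base cylinder. There the preimage of an open \<open>U\<close> is a fibre
  cylinder.\<close>

lemma continuous_map_coordinate:
  assumes "i \<in> I"
  shows "continuous_map (subtopology total (base_cyl (T i))) (Y i) (\<lambda>z. the (snd z i))"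
  unfolding continuous_map_alt
proof (intro conjI allI impI)
  fix U assume U: "openin (Y i) U"
  have "(\<lambda>z. the (snd z i)) -` U \<inter> topspace (subtopology total (base_cyl (T i))) = fibre_cyl i U"
    using assms by auto
  moreover have "fibre_cyl i U \<subseteq> base_cyl (T i)"
    by auto
  ultimately show "openin (subtopology total (base_cyl (T i)))
      ((\<lambda>z. the (snd z i)) -` U \<inter> topspace (subtopology total (base_cyl (T i))))"
    using openin_fibre_cyl[OF assms U] openin_base_cyl[OF open_T[OF assms]]
    by (simp add: openin_open_subtopology)
qed (use assms in \<open>auto simp: points_def base_cyl_def\<close>)

section \<open>Sections over the base: connectedness, path-connectedness and density\<close>

definition sect :: "('i \<Rightarrow> 'b) \<Rightarrow> 'c \<Rightarrow> 'c \<times> ('i \<rightharpoonup> 'b)" where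
  "sect f q = (q, \<lambda>i. if i \<in> I \<and> q \<in> T i then Some (f i) else None)"

lemma sect_in_points:
  assumes "\<And>i. i \<in> I \<Longrightarrow> f i \<in> topspace (Y i)" and "q \<in> topspace Z"
  shows "sect f q \<in> points"
  using assms by (auto simp: points_def sect_def split: if_splits)

text \<open>Along a section each coordinate is constant wherever it is defined. So the preimage of a
  fibre cylinder over \<open>i\<close> is \<open>T i\<close> or empty, according to whether
  \<open>f i\<close> lies in \<open>U\<close>.\<close>

lemma continuous_map_sect:
  assumes f: "\<And>i. i \<in> I \<Longrightarrow> f i \<in> topspace (Y i)"
  shows "continuous_map Z total (sect f)"
proof (rule continuous_map_into_total)
  show "sect f \<in> topspace Z \<rightarrow> points"
    using sect_in_points[OF f] by blast
next
  fix V assume "openin Z V"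
  then have "{x \<in> topspace Z. fst (sect f x) \<in> V} = V"
    using openin_subset by (fastforce simp: sect_def)
  then show "openin Z {x \<in> topspace Z. fst (sect f x) \<in> V}"
    using \<open>openin Z V\<close> by simp
next
  fix i U assume i: "i \<in> I"
  have "{x \<in> topspace Z. i \<in> dom (snd (sect f x)) \<and> the (snd (sect f x) i) \<in> U}
      = (if f i \<in> U then T i else {})"
    using i open_T[OF i, THEN openin_subset] by (auto simp: sect_def split: if_splits)
  then show "openin Z {x \<in> topspace Z. i \<in> dom (snd (sect f x)) \<and> the (snd (sect f x) i) \<in> U}"
    using open_T[OF i] by simp
qed

lemma points_on_sect:
  assumes "\<And>i. i \<in> I \<Longrightarrow> topspace (Y i) \<noteq> {}" and z: "z \<in> points"
  obtains f q where "\<And>i. i \<in> I \<Longrightarrow> f i \<in> topspace (Y i)" "q \<in> topspace Z" "z = sect f q"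
proof
  \<comment> \<open>The coordinates of \<open>z\<close> fix the choice on its domain. Elsewhere any
    point of the nonempty factor will do, since the section at \<open>fst z\<close> does not see
    it.\<close>
  define f where "f i = (if i \<in> dom (snd z) then the (snd z i) else (SOME b. b \<in> topspace (Y i)))" for i
  show "f i \<in> topspace (Y i)" if "i \<in> I" for i
    using coordinate_in_topspace[OF z, of i] assms(1)[OF that]
    by (simp add: f_def some_in_eq del: null_topspace_iff_trivial)
  have "snd z i = snd (sect f (fst z)) i" for i
    using mem_dom_iff[OF z, of i] by (auto simp: sect_def f_def)
  then show "z = sect f (fst z)"
    by (simp add: prod_eq_iff sect_def fun_eq_iff)
  show "fst z \<in> topspace Z"
    using z by (simp add: points_def)
qed

lemma sect_eq_off_T: "(\<And>i. i \<in> I \<Longrightarrow> p \<notin> T i) \<Longrightarrow> sect f p = (p, Map.empty)"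
  by (auto simp: sect_def)

text \<open>The point \<open>p\<close> lies in no \<open>T i\<close>, so every section passes
  through \<open>(p, Map.empty)\<close>. Each point lies on a section, which is a continuous image
  of \<open>Z\<close>, and so shares a component with that common point.\<close>

lemma connected_space_total:
  assumes ne: "\<And>i. i \<in> I \<Longrightarrow> topspace (Y i) \<noteq> {}"
    and p: "p \<in> topspace Z" "\<And>i. i \<in> I \<Longrightarrow> p \<notin> T i"
    and Z: "connected_space Z"
  shows "connected_space total"
proof -
  have "connected_component_of total z (p, Map.empty)" if z: "z \<in> points" for z
  proof -
    obtain f q where f: "\<And>i. i \<in> I \<Longrightarrow> f i \<in> topspace (Y i)" and q: "q \<in> topspace Z" "z = sect f q"
      using points_on_sect[OF ne z] by blast
    have "connected_component_of Z q p"
      using Z[unfolded connected_space_iff_connected_component] q(1) p(1) by blast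
    then have "connected_component_of total (sect f q) (sect f p)"
      using connected_component_of_continuous_image continuous_map_sect[OF f] by metis
    then show ?thesis
      by (simp add: q(2) sect_eq_off_T[OF p(2)])
  qed
  then show ?thesis
    unfolding connected_space_iff_connected_component topspace_total
    using connected_component_of_sym connected_component_of_trans by meson
qed

lemma path_connected_space_total:
  assumes ne: "\<And>i. i \<in> I \<Longrightarrow> topspace (Y i) \<noteq> {}"
    and p: "p \<in> topspace Z" "\<And>i. i \<in> I \<Longrightarrow> p \<notin> T i"
    and Z: "path_connected_space Z"
  shows "path_connected_space total"
proof -
  have "path_component_of total z (p, Map.empty)" if z: "z \<in> points" for z
  proof -
    obtain f q where f: "\<And>i. i \<in> I \<Longrightarrow> f i \<in> topspace (Y i)" and q: "q \<in> topspace Z" "z = sect f q"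
      using points_on_sect[OF ne z] by blast
    have "path_component_of Z q p"
      using Z[unfolded path_connected_space_iff_path_component] q(1) p(1) by blast
    then have "path_component_of total (sect f q) (sect f p)"
      using path_component_of_continuous_image continuous_map_sect[OF f] by metis
    then show ?thesis
      by (simp add: q(2) sect_eq_off_T[OF p(2)])
  qed
  then show ?thesis
    unfolding path_connected_space_iff_path_component topspace_total
    using path_component_of_sym path_component_of_trans by meson
qed

text \<open>The section through a given point is continuous and maps \<open>D\<close> into the
  cylinder over \<open>D\<close>. It therefore maps the closure of \<open>D\<close>, which is all of
  \<open>Z\<close>, into the closure of that cylinder.\<close>

lemma base_cyl_dense:
  assumes ne: "\<And>i. i \<in> I \<Longrightarrow> topspace (Y i) \<noteq> {}"
    and D: "D \<subseteq> topspace Z" "Z closure_of D = topspace Z"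
  shows "total closure_of (base_cyl D) = topspace total"
proof
  show "topspace total \<subseteq> total closure_of (base_cyl D)"
  proof
    fix z assume "z \<in> topspace total"
    then have z: "z \<in> points" by simp
    obtain f q where f: "\<And>i. i \<in> I \<Longrightarrow> f i \<in> topspace (Y i)" and q: "q \<in> topspace Z" "z = sect f q"
      using points_on_sect[OF ne z] by blast
    have "sect f ` D \<subseteq> base_cyl D"
      using sect_in_points[OF f] D(1) by auto (auto simp: sect_def)
    then have "sect f ` (Z closure_of D) \<subseteq> total closure_of (base_cyl D)"
      using continuous_map_image_closure_subset[OF continuous_map_sect[OF f]] closure_of_mono by blast
    then show "z \<in> total closure_of (base_cyl D)"
      using q D(2) by blast
  qed
qed (rule closure_of_subset_topspace)

section \<open>Separation axioms passing from the base and the factors to the total space\<close>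

lemma points_distinct:
  assumes "x \<in> points" "y \<in> points" "x \<noteq> y" "fst x = fst y"
  obtains i where "i \<in> I" "i \<in> dom (snd x)" "i \<in> dom (snd y)" "the (snd x i) \<noteq> the (snd y i)"
proof -
  obtain i where i: "snd x i \<noteq> snd y i"
    using assms(3,4) by (auto simp: prod_eq_iff)
  have "i \<in> dom (snd x) \<longleftrightarrow> i \<in> dom (snd y)"
    using assms by (simp add: mem_dom_iff)
  with i have "i \<in> dom (snd x)" "i \<in> dom (snd y)" "the (snd x i) \<noteq> the (snd y i)"
    by force+
  moreover from this have "i \<in> I"
    using mem_dom_iff[OF assms(1)] by blast
  ultimately show thesis using that by blast
qed

text \<open>Points over different base points are separated in \<open>Z\<close>. Points over the
  same base point have the same domain, so they differ in a coordinate that both possess and are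
  separated in that factor.\<close>

lemma t1_space_total:
  assumes Z: "t1_space Z" and Y: "\<And>i. i \<in> I \<Longrightarrow> t1_space (Y i)"
  shows "t1_space total"
  unfolding t1_space_def topspace_total
proof (intro ballI impI)
  fix x y assume xy: "x \<in> points" "y \<in> points" "x \<noteq> y"
  show "\<exists>U. openin total U \<and> x \<in> U \<and> y \<notin> U"
  proof (cases "fst x = fst y")
    case False
    moreover have "fst x \<in> topspace Z" "fst y \<in> topspace Z"
      using xy by (auto simp: points_def)
    ultimately obtain V where "openin Z V" "fst x \<in> V" "fst y \<notin> V"
      using Z unfolding t1_space_def by blast
    then show ?thesis
      using xy by (intro exI[of _ "base_cyl V"]) (auto simp: openin_base_cyl)
  next
    case True
    then obtain i where i: "i \<in> I" "i \<in> dom (snd x)" "i \<in> dom (snd y)" "the (snd x i) \<noteq> the (snd y i)"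
      using points_distinct xy by blast
    then obtain U where U: "openin (Y i) U" "the (snd x i) \<in> U" "the (snd y i) \<notin> U"
      using Y[OF i(1)] xy coordinate_in_topspace unfolding t1_space_def by metis
    then show ?thesis
      using xy i openin_fibre_cyl[OF i(1) U(1)]
      by (intro exI[of _ "fibre_cyl i U"]) (simp add: mem_dom_iff)
  qed
qed

text \<open>The same two cases as for T1: disjoint open sets of \<open>Z\<close>, or of one factor,
  give disjoint cylinders.\<close>

lemma Hausdorff_space_total:
  assumes Z: "Hausdorff_space Z" and Y: "\<And>i. i \<in> I \<Longrightarrow> Hausdorff_space (Y i)"
  shows "Hausdorff_space total"
  unfolding Hausdorff_space_def topspace_total
proof (intro allI impI, elim conjE)
  fix x y assume xy: "x \<in> points" "y \<in> points" "x \<noteq> y"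
  show "\<exists>U V. openin total U \<and> openin total V \<and> x \<in> U \<and> y \<in> V \<and> disjnt U V"
  proof (cases "fst x = fst y")
    case False
    moreover have "fst x \<in> topspace Z" "fst y \<in> topspace Z"
      using xy by (auto simp: points_def)
    ultimately obtain U V where "openin Z U" "openin Z V" "fst x \<in> U" "fst y \<in> V" "disjnt U V"
      using Z unfolding Hausdorff_space_def by blast
    then show ?thesis
      using xy by (intro exI[of _ "base_cyl U"] exI[of _ "base_cyl V"])
        (simp add: openin_base_cyl disjnt_iff)
  next
    case True
    then obtain i where i: "i \<in> I" "i \<in> dom (snd x)" "i \<in> dom (snd y)" "the (snd x i) \<noteq> the (snd y i)"
      using points_distinct xy by blast
    then obtain U V where UV: "openin (Y i) U" "openin (Y i) V" "the (snd x i) \<in> U"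
        "the (snd y i) \<in> V" "disjnt U V"
      using Y[OF i(1)] xy coordinate_in_topspace unfolding Hausdorff_space_def by metis
    then show ?thesis
      using xy i openin_fibre_cyl[OF i(1) UV(1)] openin_fibre_cyl[OF i(1) UV(2)]
      by (intro exI[of _ "fibre_cyl i U"] exI[of _ "fibre_cyl i V"]) (simp add: disjnt_iff mem_dom_iff)
  qed
qed

lemma closedin_base_cyl:
  assumes "closedin Z C"
  shows "closedin total (base_cyl C)"
proof -
  have "topspace total - base_cyl C = base_cyl (topspace Z - C)"
    by (auto simp: base_cyl_def points_def)
  moreover have "base_cyl C \<subseteq> topspace total"
    by (auto simp: base_cyl_def)
  ultimately show ?thesis
    using assms unfolding closedin_def by (simp only: openin_base_cyl)
qed

text \<open>A fibre cylinder over a closed \<open>D\<close> need not itself be closed, because its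
  complement contains everything over the complement of \<open>T i\<close>. Cutting down to a closed
  \<open>C\<close> inside \<open>T i\<close> helps: over \<open>C\<close> the coordinate
  \<open>i\<close> exists, so the complement is a union of two open cylinders.\<close>

lemma closedin_base_fibre_cyl:
  assumes i: "i \<in> I" and C: "closedin Z C" "C \<subseteq> T i" and D: "closedin (Y i) D"
  shows "closedin total (base_cyl C \<inter> fibre_cyl i D)"
proof -
  have "topspace total - base_cyl C \<inter> fibre_cyl i D
      = base_cyl (topspace Z - C) \<union> fibre_cyl i (topspace (Y i) - D)"
  proof (rule set_eqI)
    fix z
    have "fst z \<in> topspace Z" if "z \<in> points"
      using that by (simp add: points_def)
    moreover have "the (snd z i) \<in> topspace (Y i)" if "z \<in> points" "fst z \<in> T i"
      using that i by (intro coordinate_in_topspace) (simp_all add: mem_dom_iff)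
    ultimately show "z \<in> topspace total - base_cyl C \<inter> fibre_cyl i D \<longleftrightarrow>
        z \<in> base_cyl (topspace Z - C) \<union> fibre_cyl i (topspace (Y i) - D)"
      using C(2) i by (simp del: split_paired_All) blast
  qed
  moreover have "base_cyl C \<inter> fibre_cyl i D \<subseteq> topspace total"
    by (auto simp: base_cyl_def)
  moreover have "openin total (base_cyl (topspace Z - C) \<union> fibre_cyl i (topspace (Y i) - D))"
    using C(1) D i by (intro openin_Un openin_base_cyl openin_fibre_cyl) auto
  ultimately show ?thesis
    unfolding closedin_def by simp
qed

lemma regular_space_total:
  assumes Z: "regular_space Z" and Y: "\<And>i. i \<in> I \<Longrightarrow> regular_space (Y i)"
  shows "regular_space total"
  unfolding total_def
proof (rule regular_space_topology_generated_by, fold total_def)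
  fix B z assume "B \<in> cyls" and z: "z \<in> B"
  \<comment> \<open>Regularity of \<open>Z\<close> and of the factors in the form used below: an
    open set around a point contains a closed neighbourhood of that point.\<close>
  note Znb = Z[folded neighbourhood_base_of_closedin, unfolded neighbourhood_base_of, rule_format, OF conjI]
  note Ynb = Y[folded neighbourhood_base_of_closedin, unfolded neighbourhood_base_of, rule_format, OF _ conjI]
  from \<open>B \<in> cyls\<close> consider V where "B = base_cyl V" "openin Z V"
    | i U where "B = fibre_cyl i U" "i \<in> I" "openin (Y i) U"
    unfolding cyls_def by blast
  then show "\<exists>U C. openin total U \<and> closedin total C \<and> z \<in> U \<and> U \<subseteq> C \<and> C \<subseteq> B"
  proof cases
    case 1
    with z obtain U C where "openin Z U" "closedin Z C" "fst z \<in> U" "U \<subseteq> C" "C \<subseteq> V"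
      using Znb[OF 1(2), of "fst z"] by (auto simp: base_cyl_def)
    with 1 z show ?thesis
      by (intro exI[of _ "base_cyl U"] exI[of _ "base_cyl C"])
        (auto simp: openin_base_cyl closedin_base_cyl)
  next
    case 2
    have zp: "z \<in> points" "fst z \<in> T i" "the (snd z i) \<in> U" "i \<in> dom (snd z)"
      using z 2 mem_dom_iff[of z i] by auto
    \<comment> \<open>Shrinking is needed in both directions: \<open>T i\<close> to a closed
      \<open>C\<close> in the base, and \<open>U\<close> to a closed \<open>D\<close> in the factor.
      Only the two cuts together give a closed set.\<close>
    obtain V C where VC: "openin Z V" "closedin Z C" "fst z \<in> V" "V \<subseteq> C" "C \<subseteq> T i"
      using Znb[OF open_T[OF 2(2)] zp(2)] by blast
    obtain W D where WD: "openin (Y i) W" "closedin (Y i) D" "the (snd z i) \<in> W" "W \<subseteq> D" "D \<subseteq> U"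
      using Ynb[OF 2(2,3) zp(3)] by blast
    show ?thesis
    proof (intro exI conjI)
      show "openin total (base_cyl V \<inter> fibre_cyl i W)"
        using VC WD 2 by (intro openin_Int openin_base_cyl openin_fibre_cyl)
      show "closedin total (base_cyl C \<inter> fibre_cyl i D)"
        using VC WD 2 by (intro closedin_base_fibre_cyl)
    qed (use VC WD 2 zp in auto)
  qed
qed

text \<open>For a fibre cylinder, a function of the base point and a function of the coordinate are
  multiplied. The factor from the base vanishes off \<open>T i\<close>, so the product extends by
  zero to points that lack the coordinate.\<close>

lemma completely_regular_space_total:
  assumes Z: "completely_regular_space Z" and Y: "\<And>i. i \<in> I \<Longrightarrow> completely_regular_space (Y i)"
  shows "completely_regular_space total"
  unfolding total_def
proof (rule completely_regular_space_topology_generated_by, fold total_def)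
  fix B z assume "B \<in> cyls" and z: "z \<in> B"
  from \<open>B \<in> cyls\<close> consider V where "B = base_cyl V" "openin Z V"
    | i U where "B = fibre_cyl i U" "i \<in> I" "openin (Y i) U"
    unfolding cyls_def by blast
  then show "\<exists>f. continuous_map total euclideanreal f \<and> f z = 0 \<and> (\<forall>x\<in>topspace total - B. 1 \<le> f x)"
  proof cases
    case 1
    with z have "fst z \<in> V" by (simp add: base_cyl_def)
    then obtain f where f: "continuous_map Z euclideanreal f" "f (fst z) = 0"
        "\<forall>b\<in>topspace Z - V. f b = 1"
      using completely_regular_space_bump[OF Z 1(2)] by metis
    show ?thesis
    proof (intro exI conjI)
      show "continuous_map total euclideanreal (f \<circ> fst)"
        by (rule continuous_map_compose[OF continuous_map_fst_total f(1)])
    qed (use f 1 in \<open>auto simp: base_cyl_def points_def\<close>)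
  next
    case 2
    have zp: "z \<in> points" "fst z \<in> T i" "the (snd z i) \<in> U" "i \<in> dom (snd z)"
      using z 2 mem_dom_iff[of z i] by auto
    obtain f where f: "continuous_map Z euclideanreal f" "f (fst z) = 0"
        "\<forall>b\<in>topspace Z. 0 \<le> f b \<and> f b \<le> 1" "\<forall>b\<in>topspace Z - T i. f b = 1"
      by (rule completely_regular_space_bump[OF Z open_T[OF 2(2)] zp(2)])
    obtain g where g: "continuous_map (Y i) euclideanreal g" "g (the (snd z i)) = 0"
        "\<forall>b\<in>topspace (Y i). 0 \<le> g b \<and> g b \<le> 1" "\<forall>b\<in>topspace (Y i) - U. g b = 1"
      by (rule completely_regular_space_bump[OF Y[OF 2(2)] 2(3) zp(3)])
    \<comment> \<open>Complementing \<open>f\<close> and \<open>g\<close> gives functions equal to 1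
      at \<open>z\<close>. \<open>F\<close> vanishes off \<open>T i\<close>, and \<open>G\<close>
      vanishes over \<open>T i\<close> wherever the coordinate is outside \<open>U\<close>.\<close>
    define F where "F x = 1 - f (fst x)" for x :: "'c \<times> ('i \<rightharpoonup> 'b)"
    define G where "G x = 1 - g (the (snd x i))" for x :: "'c \<times> ('i \<rightharpoonup> 'b)"
    define k where "k x = (if x \<in> base_cyl (T i) then F x * G x else 0)" for x
    have coord: "the (snd x i) \<in> topspace (Y i)" if "x \<in> base_cyl (T i)" for x
      using that 2 by (intro coordinate_in_topspace) (auto simp only: mem_base_cyl mem_dom_iff)
    have "continuous_map total euclideanreal k"
      unfolding k_def
    proof (rule continuous_map_extend_by_zero)
      show "openin total (base_cyl (T i))"
        by (rule openin_base_cyl[OF open_T[OF 2(2)]])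
      show "continuous_map total euclideanreal F"
        using continuous_map_compose[OF continuous_map_fst_total f(1)]
        unfolding F_def by (intro continuous_map_diff) (auto simp: o_def)
      show "continuous_map (subtopology total (base_cyl (T i))) euclideanreal G"
        using continuous_map_compose[OF continuous_map_coordinate[OF 2(2)] g(1)]
        unfolding G_def by (intro continuous_map_diff) (auto simp: o_def)
      show "0 \<le> F x" if "x \<in> topspace total" for x
        using that f(3) by (auto simp: F_def points_def)
      show "F x = 0" if "x \<in> topspace total - base_cyl (T i)" for x
        using that f(4) by (auto simp: F_def points_def base_cyl_def)
      show "0 \<le> G x \<and> G x \<le> 1" if "x \<in> base_cyl (T i)" for x
        using coord[OF that] g(3) by (auto simp: G_def)
    qed
    then have "continuous_map total euclideanreal (\<lambda>x. 1 - k x)"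
      by (intro continuous_map_diff) auto
    moreover have "1 - k z = 0"
      using zp f(2) g(2) by (simp add: k_def F_def G_def base_cyl_def)
    \<comment> \<open>A point outside the cylinder either has its coordinate outside
      \<open>U\<close>, where \<open>G\<close> is 0, or lacks the coordinate, where \<open>k\<close>
      is 0 by definition.\<close>
    moreover have "1 \<le> 1 - k x" if x: "x \<in> topspace total - B" for x
    proof (cases "x \<in> base_cyl (T i)")
      case True
      then have "the (snd x i) \<notin> U"
        using x 2 by auto
      then have "G x = 0" using coord[OF True] g(4) by (simp add: G_def)
      then show ?thesis by (simp add: k_def)
    next
      case False
      then have "k x = 0" unfolding k_def by (rule if_not_P)
      then show ?thesis by simp
    qed
    ultimately show ?thesis by blast
  qed
qed

lemma T_space_total:
  assumes "T_space n Z" and "\<And>i. i \<in> I \<Longrightarrow> T_space n (Y i)"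
  shows "T_space n total"
  using assms
  by (cases n) (auto simp: t1_space_total Hausdorff_space_total regular_space_total
      completely_regular_space_total)

end

section \<open>The amalgam inside an amalgam over a larger base\<close>

lemma topspace_amalgam [simp]: "topspace (amalgam X \<S> Y) = amalgam_points X \<S> Y"
  unfolding amalgam_def by simp

lemma openin_amalgam_subbasic:
  assumes "S \<in> \<S>" "openin (Y S) U"
  shows "openin (amalgam X \<S> Y) {y \<in> amalgam_points X \<S> Y. S \<in> dom y \<and> the (y S) \<in> U}"
    (is "openin _ ?B")
proof -
  let ?P = "\<lambda>B. \<exists>S\<in>\<S>. \<exists>U. openin (Y S) U \<and>
             B = {y \<in> amalgam_points X \<S> Y. S \<in> dom y \<and> the (y S) \<in> U}"
  have "?P ?B" using assms by blast
  then have "(finite intersection_of ?P relative_to amalgam_points X \<S> Y) (amalgam_points X \<S> Y \<inter> ?B)"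
    by (rule relative_to_inc[OF finite_intersection_of_inc])
  moreover have "amalgam_points X \<S> Y \<inter> ?B = ?B" by blast
  ultimately show ?thesis
    unfolding amalgam_def openin_subbase by (simp only: arbitrary_union_of_inc)
qed

lemma continuous_map_into_amalgam:
  assumes "\<And>x. x \<in> topspace W \<Longrightarrow> f x \<in> amalgam_points X \<S> Y"
    and "\<And>S U. \<lbrakk>S \<in> \<S>; openin (Y S) U\<rbrakk> \<Longrightarrow>
      openin W {x \<in> topspace W. S \<in> dom (f x) \<and> the (f x S) \<in> U}"
  shows "continuous_map W (amalgam X \<S> Y) f"
  unfolding amalgam_def
proof (rule continuous_map_into_topology_subbase)
  fix B assume "\<exists>S\<in>\<S>. \<exists>U. openin (Y S) U \<and>
      B = {y \<in> amalgam_points X \<S> Y. S \<in> dom y \<and> the (y S) \<in> U}"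
  then obtain S U where SU: "S \<in> \<S>" "openin (Y S) U"
      "B = {y \<in> amalgam_points X \<S> Y. S \<in> dom y \<and> the (y S) \<in> U}" by blast
  then have "{x \<in> topspace W. f x \<in> B} = {x \<in> topspace W. S \<in> dom (f x) \<and> the (f x S) \<in> U}"
    using assms(1) by auto
  then show "openin W {x \<in> topspace W. f x \<in> B}"
    using assms(2) SU by simp
qed (use assms(1) in simp)

section \<open>Recovering the base point of an amalgam point from its domain\<close>

lemma subbase_of_openin_mono:
  assumes sb: "subbase_of X \<S>" and U: "openin X U" "p \<in> U"
    and q: "q \<in> topspace X" "\<And>S. \<lbrakk>S \<in> \<S>; p \<in> S\<rbrakk> \<Longrightarrow> q \<in> S"
  shows "q \<in> U"
proof -
  have eq: "openin X = arbitrary union_of (finite intersection_of (\<lambda>S. S \<in> \<S>) relative_to topspace X)"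
    using sb unfolding subbase_of_def by (rule conjunct2)
  have "(arbitrary union_of (finite intersection_of (\<lambda>S. S \<in> \<S>) relative_to topspace X)) U"
    using fun_cong[OF eq] U(1) by (rule iffD1)
  \<comment> \<open>\<open>V\<close> is an intersection of subbase members, each of them containing
    \<open>p\<close> and hence \<open>q\<close>.\<close>
  then obtain V where V: "(finite intersection_of (\<lambda>S. S \<in> \<S>) relative_to topspace X) V" "p \<in> V" "V \<subseteq> U"
    using U(2) unfolding union_of_def arbitrary_def by blast
  then obtain \<F> where "\<F> \<subseteq> \<S>" "V = topspace X \<inter> \<Inter>\<F>"
    by (auto simp: relative_to_def intersection_of_def)
  with V q show ?thesis by blast
qed

lemma subbase_of_separates:
  assumes "subbase_of X \<S>" "t0_space X" "p \<in> topspace X" "q \<in> topspace X"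
    and "{S \<in> \<S>. p \<in> S} = {S \<in> \<S>. q \<in> S}"
  shows "p = q"
proof (rule ccontr)
  assume "p \<noteq> q"
  then obtain U where "openin X U" "p \<notin> U \<longleftrightarrow> q \<in> U"
    using assms(2-4) unfolding t0_space_def by blast
  then show False
    using subbase_of_openin_mono[OF assms(1), of U p q] subbase_of_openin_mono[OF assms(1), of U q p]
      assms(3-5) by blast
qed

text \<open>The projection of the amalgam onto its base space. A point of the amalgam does not
  record its base point, but in a T0 space the subbase members around a point determine it.\<close>

definition amalgam_base :: "'a topology \<Rightarrow> 'a set set \<Rightarrow> ('a set \<rightharpoonup> 'b) \<Rightarrow> 'a" where
  "amalgam_base X \<S> y = (THE p. p \<in> topspace X \<and> dom y = {S \<in> \<S>. p \<in> S})"

lemma amalgam_base_eq: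
  assumes "subbase_of X \<S>" "t0_space X" "p \<in> topspace X" "dom y = {S \<in> \<S>. p \<in> S}"
  shows "amalgam_base X \<S> y = p"
  unfolding amalgam_base_def
  using assms by (intro the_equality) (auto intro: subbase_of_separates)

lemma amalgam_base:
  assumes "subbase_of X \<S>" "t0_space X" "y \<in> amalgam_points X \<S> Y"
  shows "amalgam_base X \<S> y \<in> topspace X" "dom y = {S \<in> \<S>. amalgam_base X \<S> y \<in> S}"
proof -
  obtain p where p: "p \<in> topspace X" "dom y = {S \<in> \<S>. p \<in> S}"
    using assms(3) unfolding amalgam_points_def by blast
  have "amalgam_base X \<S> y = p"
    by (rule amalgam_base_eq[OF assms(1,2) p])
  with p show "amalgam_base X \<S> y \<in> topspace X" "dom y = {S \<in> \<S>. amalgam_base X \<S> y \<in> S}"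
    by simp_all
qed

text \<open>It suffices to pull back subbase members. The base point lies in \<open>S\<close>
  exactly when \<open>S\<close> belongs to the domain, so the preimage of \<open>S\<close> is the
  subbasic set of the amalgam given by the whole factor \<open>Y S\<close>.\<close>

lemma continuous_map_amalgam_base:
  assumes sb: "subbase_of X \<S>" and t0: "t0_space X"
  shows "continuous_map (amalgam X \<S> Y) X (amalgam_base X \<S>)"
proof -
  have X: "X = topology (arbitrary union_of (finite intersection_of (\<lambda>S. S \<in> \<S>) relative_to topspace X))"
    using sb openin_inverse[of X] unfolding subbase_of_def by simp
  show ?thesis
    unfolding continuous_map_into_topology_subbase_eq[OF X]
  proof (intro conjI allI impI)
    show "amalgam_base X \<S> \<in> topspace (amalgam X \<S> Y) \<rightarrow> topspace X"
      using amalgam_base(1)[OF sb t0] by auto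
    fix S assume S: "S \<in> \<S>"
    have "amalgam_base X \<S> y \<in> S \<longleftrightarrow> S \<in> dom y \<and> the (y S) \<in> topspace (Y S)"
      if "y \<in> amalgam_points X \<S> Y" for y
    proof -
      have "\<forall>S\<in>dom y. the (y S) \<in> topspace (Y S)"
        using that unfolding amalgam_points_def by blast
      then show ?thesis
        using S amalgam_base(2)[OF sb t0 that] by blast
    qed
    then have "{y \<in> topspace (amalgam X \<S> Y). amalgam_base X \<S> y \<in> S}
        = {y \<in> amalgam_points X \<S> Y. S \<in> dom y \<and> the (y S) \<in> topspace (Y S)}"
      unfolding topspace_amalgam by blast
    then show "openin (amalgam X \<S> Y) {y \<in> topspace (amalgam X \<S> Y). amalgam_base X \<S> y \<in> S}"
      using openin_amalgam_subbasic[where Y=Y, OF S openin_topspace] by simp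
  qed
qed

lemma embedding_map_amalgam:
  fixes Z :: "'c topology" and e :: "'a \<Rightarrow> 'c" and Y :: "'a set \<Rightarrow> 'b topology"
  assumes sb: "subbase_of X \<S>" and t0: "t0_space X" and e: "embedding_map X Z e"
    and T: "\<And>S. S \<in> \<S> \<Longrightarrow> openin Z (T S)" "\<And>S. S \<in> \<S> \<Longrightarrow> {x \<in> topspace X. e x \<in> T S} = S"
  defines "j \<equiv> \<lambda>y. (e (amalgam_base X \<S> y), y)"
  shows "embedding_map (amalgam X \<S> Y) (indexed_amalgam.total Z \<S> T Y) j"
    and "j ` amalgam_points X \<S> Y = indexed_amalgam.base_cyl Z \<S> T Y (e ` topspace X)"
proof -
  interpret indexed_amalgam Z \<S> T Y
    by unfold_locales (rule T(1))
  have e_cont: "continuous_map X Z e"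
    using continuous_map_into_fulltopology[OF homeomorphic_imp_continuous_map] e
    unfolding embedding_map_def .
  have e_in: "e x \<in> topspace Z" if "x \<in> topspace X" for x
    using continuous_map_image_subset_topspace[OF e_cont] that by blast
  have dom_T: "{S \<in> \<S>. e x \<in> T S} = {S \<in> \<S>. x \<in> S}" if "x \<in> topspace X" for x
    using T(2) that by blast
  have j_in: "j y \<in> points" if y: "y \<in> amalgam_points X \<S> Y" for y
  proof -
    have "\<forall>S\<in>dom y. the (y S) \<in> topspace (Y S)"
      using y unfolding amalgam_points_def by blast
    then show ?thesis
      using amalgam_base[OF sb t0 y] e_in dom_T by (simp add: j_def points_def)
  qed
  show img: "j ` amalgam_points X \<S> Y = base_cyl (e ` topspace X)"
  proof
    show "j ` amalgam_points X \<S> Y \<subseteq> base_cyl (e ` topspace X)"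
    proof (rule image_subsetI)
      fix y assume y: "y \<in> amalgam_points X \<S> Y"
      then show "j y \<in> base_cyl (e ` topspace X)"
        using j_in[OF y] amalgam_base(1)[OF sb t0 y] by (simp add: j_def)
    qed
    show "base_cyl (e ` topspace X) \<subseteq> j ` amalgam_points X \<S> Y"
    proof
      fix z assume "z \<in> base_cyl (e ` topspace X)"
      then obtain x where x: "x \<in> topspace X" "fst z = e x" and z: "z \<in> points"
        by (auto simp: base_cyl_def)
      have dom: "dom (snd z) = {S \<in> \<S>. x \<in> S}"
        using z x dom_T[OF x(1)] by (auto simp: points_def)
      then have "snd z \<in> amalgam_points X \<S> Y"
        using z x by (auto simp: points_def amalgam_points_def)
      moreover have "z = j (snd z)"
        using amalgam_base_eq[OF sb t0 x(1) dom] x(2) by (simp add: j_def prod_eq_iff)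
      ultimately show "z \<in> j ` amalgam_points X \<S> Y" by blast
    qed
  qed
  have "homeomorphic_maps (amalgam X \<S> Y) (subtopology total (j ` amalgam_points X \<S> Y)) j snd"
    unfolding homeomorphic_maps_def
  proof (intro conjI)
    have "continuous_map (amalgam X \<S> Y) total j"
    proof (rule continuous_map_into_total)
      show "j \<in> topspace (amalgam X \<S> Y) \<rightarrow> points"
        using j_in by simp
      show "openin (amalgam X \<S> Y) {x \<in> topspace (amalgam X \<S> Y). fst (j x) \<in> V}"
        if "openin Z V" for V
        \<comment> \<open>The first component of \<open>j\<close> is \<open>e\<close> after the
          projection to the base, a composition of continuous maps.\<close>
        using openin_continuous_map_preimage[OF continuous_map_compose[OF
              continuous_map_amalgam_base[OF sb t0, of Y] e_cont] that]
        by (simp add: j_def)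
      show "openin (amalgam X \<S> Y) {x \<in> topspace (amalgam X \<S> Y). S \<in> dom (snd (j x)) \<and> the (snd (j x) S) \<in> U}"
        if "S \<in> \<S>" "openin (Y S) U" for S U
        using openin_amalgam_subbasic[where Y=Y, OF that] by (simp add: j_def)
    qed
    then show "continuous_map (amalgam X \<S> Y) (subtopology total (j ` amalgam_points X \<S> Y)) j"
      by (simp add: continuous_map_in_subtopology)
    show "continuous_map (subtopology total (j ` amalgam_points X \<S> Y)) (amalgam X \<S> Y) snd"
    proof (rule continuous_map_into_amalgam)
      fix S U assume SU: "S \<in> \<S>" "openin (Y S) U"
      have "{x \<in> topspace (subtopology total (j ` amalgam_points X \<S> Y)).
            S \<in> dom (snd x) \<and> the (snd x S) \<in> U} = fibre_cyl S U \<inter> j ` amalgam_points X \<S> Y"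
        unfolding topspace_subtopology topspace_total fibre_cyl_def by blast
      then show "openin (subtopology total (j ` amalgam_points X \<S> Y))
          {x \<in> topspace (subtopology total (j ` amalgam_points X \<S> Y)).
            S \<in> dom (snd x) \<and> the (snd x S) \<in> U}"
        using openin_fibre_cyl[OF SU] by (simp add: openin_subtopology_Int)
    qed (auto simp: j_def)
  qed (auto simp: j_def)
  then show "embedding_map (amalgam X \<S> Y) total j"
    unfolding embedding_map_def topspace_amalgam using homeomorphic_maps_map by blast
qed

text \<open>The image of \<open>S\<close> is open in the image of \<open>X\<close>, hence the trace
  of an open set of \<open>Z\<close>. Deleting \<open>p\<close> leaves that set open by T1, and
  leaves its trace unchanged because \<open>p\<close> is outside the image.\<close>

lemma open_extensions_avoiding:
  assumes e: "embedding_map X Z e" and Z: "t1_space Z"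
    and p: "p \<in> topspace Z" "p \<notin> e ` topspace X"
    and op: "\<And>S. S \<in> \<S> \<Longrightarrow> openin X S"
  obtains T where "\<And>S. S \<in> \<S> \<Longrightarrow> openin Z (T S)" "\<And>S. S \<in> \<S> \<Longrightarrow> p \<notin> T S"
    "\<And>S. S \<in> \<S> \<Longrightarrow> {x \<in> topspace X. e x \<in> T S} = S"
proof -
  have "\<exists>V. openin Z V \<and> p \<notin> V \<and> {x \<in> topspace X. e x \<in> V} = S" if S: "S \<in> \<S>" for S
  proof -
    have SX: "S \<subseteq> topspace X" using op[OF S] openin_subset by blast
    have hom: "homeomorphic_map X (subtopology Z (e ` topspace X)) e"
      using e by (simp add: embedding_map_def)
    then have inj: "inj_on e (topspace X)"
      by (simp add: homeomorphic_eq_everything_map)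
    have "openin (subtopology Z (e ` topspace X)) (e ` S)"
      using hom op[OF S] SX homeomorphic_map_openness by blast
    then obtain O' where O': "openin Z O'" "e ` S = O' \<inter> e ` topspace X"
      by (auto simp: openin_subtopology)
    have "openin Z (O' - {p})"
      using O'(1) Z p(1) by (auto simp: t1_space_closedin_singleton intro: openin_diff)
    moreover have "{x \<in> topspace X. e x \<in> O' - {p}} = S"
    proof
      show "{x \<in> topspace X. e x \<in> O' - {p}} \<subseteq> S"
      proof
        fix x assume "x \<in> {x \<in> topspace X. e x \<in> O' - {p}}"
        then have x: "x \<in> topspace X" "e x \<in> O'" by simp_all
        then have "e x \<in> e ` S" using O'(2) by blast
        then show "x \<in> S" using inj x(1) SX by (auto dest: inj_onD)
      qed
      show "S \<subseteq> {x \<in> topspace X. e x \<in> O' - {p}}"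
        using O'(2) SX p(2) by blast
    qed
    ultimately show ?thesis by blast
  qed
  then show thesis using that by metis
qed

theorem corollary3p3:
  fixes X :: "'a topology"
    and \<S> :: "'a set set"
    and Y :: "'a set \<Rightarrow> 'b topology"
    and Xt :: "'c topology"
    and i :: sep_index
  assumes "topspace X \<noteq> {}"
    and "t0_space X"
    and "subbase_of X \<S>"
    and "{} \<notin> \<S>"
    and "\<And>S. S \<in> \<S> \<Longrightarrow> topspace (Y S) \<noteq> {}"
    and "proper_connectification Xt X"
    and "T_space i Xt"
    and "\<And>S. S \<in> \<S> \<Longrightarrow> T_space i (Y S)"
  shows "\<exists>Yt :: ('c \<times> ('a set \<rightharpoonup> 'b)) topology.
           proper_connectification Yt (amalgam X \<S> Y) \<and> T_space i Yt \<and>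
           (path_connected_space Xt \<longrightarrow> path_connected_space Yt)"
proof -
  obtain e where conn: "connected_space Xt" and emb: "embedding_map X Xt e"
    and dense: "Xt closure_of (e ` topspace X) = topspace Xt"
    and proper: "e ` topspace X \<noteq> topspace Xt"
    using assms(6) by (auto simp: proper_connectification_def connectification_def dense_embedding_def)
  have sub: "e ` topspace X \<subseteq> topspace Xt"
    using emb unfolding embedding_map_def
    by (metis continuous_map_image_subset_topspace homeomorphic_imp_continuous_map
        continuous_map_into_fulltopology)
  then obtain p where p: "p \<in> topspace Xt" "p \<notin> e ` topspace X"
    using proper by blast
  have "\<forall>S\<in>\<S>. openin X S"
    using assms(3) unfolding subbase_of_def by (rule conjunct1)
  then obtain T where T: "\<And>S. S \<in> \<S> \<Longrightarrow> openin Xt (T S)" "\<And>S. S \<in> \<S> \<Longrightarrow> p \<notin> T S"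
      "\<And>S. S \<in> \<S> \<Longrightarrow> {x \<in> topspace X. e x \<in> T S} = S"
    using open_extensions_avoiding[OF emb T_space_imp_t1_space[OF assms(7)] p, of \<S>] by blast
  interpret indexed_amalgam Xt \<S> T Y
    by unfold_locales (rule T(1))
  define j where "j y = (e (amalgam_base X \<S> y), y)" for y :: "'a set \<rightharpoonup> 'b"
  have j_emb: "embedding_map (amalgam X \<S> Y) total j"
    and j_img: "j ` amalgam_points X \<S> Y = base_cyl (e ` topspace X)"
    using embedding_map_amalgam[OF assms(3,2) emb T(1,3), of Y] by (simp_all add: j_def[abs_def])
  have "dense_embedding (amalgam X \<S> Y) total j"
    using j_emb base_cyl_dense[OF assms(5) sub dense] j_img by (simp add: dense_embedding_def)
  moreover have "j ` topspace (amalgam X \<S> Y) \<noteq> topspace total"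
  proof -
    \<comment> \<open>No \<open>T S\<close> contains \<open>p\<close>, so the empty map is a
      legitimate point over \<open>p\<close>. It is not in the image of the amalgam, which makes the
      embedding proper.\<close>
    have "(p, Map.empty) \<in> points - base_cyl (e ` topspace X)"
      using p T(2) by (auto simp: points_def base_cyl_def)
    then show ?thesis
      unfolding topspace_amalgam topspace_total j_img by blast
  qed
  moreover have "connected_space total"
    using connected_space_total[OF assms(5) p(1) T(2) conn] .
  ultimately have "proper_connectification total (amalgam X \<S> Y)"
    unfolding proper_connectification_def connectification_def by blast
  moreover have "T_space i total"
    using T_space_total assms(7,8) by blast
  moreover have "path_connected_space Xt \<longrightarrow> path_connected_space total"
    using path_connected_space_total[OF assms(5) p(1) T(2)] by blast
  ultimately show ?thesis by blast
qed

end
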